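(* Let $p$ be an odd prime, and let $E$ be the group given in the variety $\mathcal N_{2,p}$ by the presentation $$E=\langle \{x_i\}_{i\in\mathbb N},\, z \;:\; [x_i,x_k]=z \ \ (0\le i<k)\rangle .$$ Then $E$ is word automatic.
   Context: $\mathbb N=\{0,1,2,\dots\}$ and $[x,y]=x^{-1}y^{-1}xy$. $\mathcal N_{2,p}$ is the variety of groups satisfying the laws $[[x,y],z]=1$ and $x^p=1$. A presentation in the variety $\mathcal N_{2,p}$ denotes the quotient of the free group of $\mathcal N_{2,p}$ on the listed generators by the normal subgroup generated by the listed relations. Convolution: let $\Sigma$ be a finite alphabet and $\Diamond\notin\Sigma$ a filler symbol. For $\sigma_1,\dots,\sigma_n\in\Sigma^*$, extend each string on the right by symbols $\Diamond$ to the common length $\max_i|\sigma_i|$, and stack the resulting strings on top of each other to obtain a single string over the alphabet $(\Sigma\cup\{\Diamond\})^n$. A relation $S\subseteq(\Sigma^* )^n$ is FA-recognizable if the set of convolutions of its tuples is a regular language over $(\Sigma\cup\{\Diamond\})^n$. Word automatic: a group $G$ is word automatic (FA-presentable) if there are a finite alphabet $\Sigma$, a regular language $D\subseteq\Sigma^*$ and a surjection $\pi:D\to G$ (elements may be represented by more than one string) such that the relations $\{(\sigma,\tau)\in D^2:\pi(\sigma)=\pi(\tau)\}$ and $\{(\sigma,\tau,\rho)\in D^3:\pi(\sigma)\pi(\tau)=\pi(\rho)\}$ are FA-recognizable. (This is not the notion of automatic group in the sense of Thurston and Epstein.) *)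

theory Defs
  imports "HOL-Algebra.Coset" "HOL-Computational_Algebra.Primes"
begin

section \<open>Groups given by presentations in a variety\<close>

definition commutator :: "('a, 'b) monoid_scheme \<Rightarrow> 'a \<Rightarrow> 'a \<Rightarrow> 'a" where
  "commutator G x y = inv\<^bsub>G\<^esub> x \<otimes>\<^bsub>G\<^esub> inv\<^bsub>G\<^esub> y \<otimes>\<^bsub>G\<^esub> x \<otimes>\<^bsub>G\<^esub> y"

definition normal_closure :: "('a, 'b) monoid_scheme \<Rightarrow> 'a set \<Rightarrow> 'a set" where
  "normal_closure G S = \<Inter> {N. N \<lhd> G \<and> S \<subseteq> N}"

text \<open>A word over the generators is a list of signed letters: \<open>(a, True)\<close> is the generator \<open>a\<close>
  and \<open>(a, False)\<close> is its formal inverse.\<close>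

inductive cancels :: "('a \<times> bool) list \<Rightarrow> ('a \<times> bool) list \<Rightarrow> bool" where
  "cancels (u @ (a, s) # (a, \<not> s) # v) (u @ v)"

definition word_rel :: "(('a \<times> bool) list \<times> ('a \<times> bool) list) set" where
  "word_rel = {(u, v). equivclp cancels u v}"

definition free_group :: "('a \<times> bool) list set monoid" where
  "free_group =
    \<lparr>carrier = UNIV // word_rel,
     monoid.mult = (\<lambda>A B. \<Union>u\<in>A. \<Union>v\<in>B. word_rel `` {u @ v}),
     one = word_rel `` {[]}\<rparr>"

text \<open>All values in \<open>G\<close> of the two words \<open>[[x, y], z]\<close> and \<open>x\<^sup>p\<close>.\<close>

definition N2_law_values :: "nat \<Rightarrow> ('a, 'b) monoid_scheme \<Rightarrow> 'a set" where
  "N2_law_values p G =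
    {commutator G (commutator G x y) z | x y z. x \<in> carrier G \<and> y \<in> carrier G \<and> z \<in> carrier G}
    \<union> {x [^]\<^bsub>G\<^esub> p | x. x \<in> carrier G}"

definition in_N2 :: "nat \<Rightarrow> ('a, 'b) monoid_scheme \<Rightarrow> bool" where
  "in_N2 p G \<longleftrightarrow> group G \<and> N2_law_values p G \<subseteq> {\<one>\<^bsub>G\<^esub>}"

text \<open>The free group of the variety is the absolutely free group modulo its verbal subgroup;
  its universal property is \<open>free_N2_universal\<close> below.\<close>

definition N2_verbal :: "nat \<Rightarrow> ('a \<times> bool) list set set" where
  "N2_verbal p = normal_closure free_group (N2_law_values p free_group)"

definition free_N2 :: "nat \<Rightarrow> ('a \<times> bool) list set set monoid" where
  "free_N2 p = free_group Mod N2_verbal p"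

definition gen_N2 :: "nat \<Rightarrow> 'a \<Rightarrow> ('a \<times> bool) list set set" where
  "gen_N2 p a = N2_verbal p #>\<^bsub>free_group\<^esub> (word_rel `` {[(a, True)]})"

text \<open>The relations \<open>R\<close> are pairs \<open>(u, v)\<close>, read \<open>u = v\<close>, of elements of the free group of the
  variety; the set of generators is the whole type \<open>'a\<close>.\<close>

definition presented_N2 ::
  "nat \<Rightarrow> (('a \<times> bool) list set set \<times> ('a \<times> bool) list set set) set
    \<Rightarrow> ('a \<times> bool) list set set set monoid" where
  "presented_N2 p R =
    free_N2 p Mod normal_closure (free_N2 p) {u \<otimes>\<^bsub>free_N2 p\<^esub> inv\<^bsub>free_N2 p\<^esub> v | u v. (u, v) \<in> R}"

datatype E_gen = X nat | Z

definition E_relations ::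
  "nat \<Rightarrow> ((E_gen \<times> bool) list set set \<times> (E_gen \<times> bool) list set set) set" where
  "E_relations p =
    {(commutator (free_N2 p) (gen_N2 p (X i)) (gen_N2 p (X k)), gen_N2 p Z) | i k. i < k}"

definition group_E :: "nat \<Rightarrow> (E_gen \<times> bool) list set set set monoid" where
  "group_E p = presented_N2 p (E_relations p)"


section \<open>Word automatic structures\<close>

text \<open>A language is regular over \<open>A\<close> if it is accepted by a deterministic finite automaton with
  input alphabet \<open>A\<close>.  The states are numbered, which loses no generality.\<close>

definition regular_over :: "'a set \<Rightarrow> 'a list set \<Rightarrow> bool" where
  "regular_over A L \<longleftrightarrow>
    (\<exists>(Q :: nat set) q0 \<delta> F.
      finite Q \<and> q0 \<in> Q \<and> F \<subseteq> Q \<and> (\<forall>q\<in>Q. \<forall>a\<in>A. \<delta> q a \<in> Q) \<and>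
      L = {w \<in> lists A. foldl \<delta> q0 w \<in> F})"

text \<open>An \<open>n\<close>-tuple of words is a list of length \<open>n\<close>, and a column of the stacked words is a list
  of length \<open>n\<close> over the alphabet extended by the filler symbol \<open>None\<close>.\<close>

definition convolution :: "'a list list \<Rightarrow> 'a option list list" where
  "convolution ws =
    map (\<lambda>j. map (\<lambda>w. if j < length w then Some (w ! j) else None) ws)
      [0..<Max (length ` set ws)]"

definition columns :: "nat \<Rightarrow> 'a set \<Rightarrow> 'a option list set" where
  "columns n A = {c. length c = n \<and> set c \<subseteq> insert None (Some ` A)}"

definition FA_recognizable :: "nat \<Rightarrow> 'a set \<Rightarrow> 'a list list set \<Rightarrow> bool" where
  "FA_recognizable n A S \<longleftrightarrow>
    (\<forall>ws\<in>S. length ws = n \<and> set ws \<subseteq> lists A) \<and>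
    regular_over (columns n A) (convolution ` S)"

text \<open>The letters of the finite alphabet are numbered, which loses no generality.\<close>

definition word_automatic :: "('g, 'b) monoid_scheme \<Rightarrow> bool" where
  "word_automatic G \<longleftrightarrow>
    group G \<and>
    (\<exists>(A :: nat set) D \<pi>.
      finite A \<and> regular_over A D \<and> \<pi> ` D = carrier G \<and>
      FA_recognizable 2 A {[\<sigma>, \<tau>] | \<sigma> \<tau>. \<sigma> \<in> D \<and> \<tau> \<in> D \<and> \<pi> \<sigma> = \<pi> \<tau>} \<and>
      FA_recognizable 3 A
        {[\<sigma>, \<tau>, \<rho>] | \<sigma> \<tau> \<rho>. \<sigma> \<in> D \<and> \<tau> \<in> D \<and> \<rho> \<in> D \<and> \<pi> \<sigma> \<otimes>\<^bsub>G\<^esub> \<pi> \<tau> = \<pi> \<rho>})"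


section \<open>The constructions are groups with the expected universal property\<close>

lemma equiv_word_rel: "equiv UNIV word_rel"
  by (auto simp: word_rel_def equiv_def refl_on_def sym_def trans_def
      intro: equivclp_sym equivclp_trans)

lemma cancels_append: "cancels u v \<Longrightarrow> cancels (x @ u @ y) (x @ v @ y)"
  by (elim cancels.cases) (metis append.assoc append_Cons cancels.intros)

lemma word_rel_append1: "(u, v) \<in> word_rel \<Longrightarrow> (x @ u @ y, x @ v @ y) \<in> word_rel"
  unfolding word_rel_def mem_Collect_eq prod.case
  by (induction rule: equivclp_induct) (auto intro: equivclp_into_equivclp cancels_append)

lemma word_rel_append:
  "(u, u') \<in> word_rel \<Longrightarrow> (v, v') \<in> word_rel \<Longrightarrow> (u @ v, u' @ v') \<in> word_rel"
  using word_rel_append1[of u u' "[]" v] word_rel_append1[of v v' u' "[]"]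
    equivE[OF equiv_word_rel] by (auto dest: transD)

lemma free_group_mult:
  "word_rel `` {u} \<otimes>\<^bsub>free_group\<^esub> word_rel `` {v} = word_rel `` {u @ v}"
proof -
  have "(\<lambda>u v. word_rel `` {u @ v}) respects2 word_rel"
    unfolding congruent2_def by (auto intro!: equiv_class_eq[OF equiv_word_rel] word_rel_append)
  from UN_equiv_class2[OF equiv_word_rel equiv_word_rel this] show ?thesis
    by (simp add: free_group_def)
qed

lemma free_group_carrier: "carrier free_group = range (\<lambda>w. word_rel `` {w})"
  by (auto simp: free_group_def quotient_def)

lemma word_rel_inverse: "(rev (map (\<lambda>(a, s). (a, \<not> s)) w) @ w, []) \<in> word_rel"
proof (induction w)
  case Nil
  then show ?case by (simp add: word_rel_def)
next
  case (Cons l w)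
  obtain a s where l: "l = (a, s)" by (cases l)
  let ?r = "rev (map (\<lambda>(a, s). (a, \<not> s)) w)"
  have "cancels (?r @ (a, \<not> s) # (a, \<not> \<not> s) # w) (?r @ w)"
    by (rule cancels.intros)
  then have "(?r @ (a, \<not> s) # (a, s) # w, ?r @ w) \<in> word_rel"
    by (auto simp: word_rel_def)
  then show ?case
    using Cons.IH equivE[OF equiv_word_rel] by (auto simp: l dest: transD)
qed

lemma group_free_group: "group free_group"
proof (rule groupI)
  fix x :: "('a \<times> bool) list set" assume "x \<in> carrier free_group"
  then obtain w where w: "x = word_rel `` {w}" by (auto simp: free_group_carrier)
  let ?y = "word_rel `` {rev (map (\<lambda>(a, s). (a, \<not> s)) w)}"
  have "?y \<otimes>\<^bsub>free_group\<^esub> x = \<one>\<^bsub>free_group\<^esub>"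
    unfolding w free_group_mult
    using equiv_class_eq[OF equiv_word_rel word_rel_inverse[of w]] by (simp add: free_group_def)
  then show "\<exists>y\<in>carrier free_group. y \<otimes>\<^bsub>free_group\<^esub> x = \<one>\<^bsub>free_group\<^esub>"
    by (auto simp: free_group_carrier)
  have one: "\<one>\<^bsub>free_group\<^esub> = word_rel `` {[] :: ('a \<times> bool) list}"
    by (simp add: free_group_def)
  show "\<one>\<^bsub>free_group\<^esub> \<otimes>\<^bsub>free_group\<^esub> x = x"
    unfolding w one free_group_mult by simp
next
  have "\<one>\<^bsub>free_group\<^esub> = word_rel `` {[] :: ('a \<times> bool) list}"
    by (simp add: free_group_def)
  then show "\<one>\<^bsub>free_group\<^esub> \<in> carrier (free_group :: ('a \<times> bool) list set monoid)"
    by (auto simp: free_group_carrier)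
qed (auto simp: free_group_carrier free_group_mult)

lemma normal_normal_closure:
  assumes "group G" "S \<subseteq> carrier G"
  shows "normal_closure G S \<lhd> G"
proof -
  interpret group G by fact
  have "carrier G \<lhd> G"
    by (rule normal_invI[OF subgroup_self]) auto
  then have ne: "{N. N \<lhd> G \<and> S \<subseteq> N} \<noteq> {}" using assms(2) by auto
  have "subgroup (normal_closure G S) G"
    unfolding normal_closure_def
    by (rule subgroups_Inter) (use ne in \<open>auto intro: normal_imp_subgroup\<close>)
  then show ?thesis
    by (rule normal_invI) (auto simp: normal_closure_def normal_inv_iff)
qed

lemma normal_closure_incl: "S \<subseteq> normal_closure G S"
  by (auto simp: normal_closure_def)

lemma normal_closure_least: "N \<lhd> G \<Longrightarrow> S \<subseteq> N \<Longrightarrow> normal_closure G S \<subseteq> N"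
  by (auto simp: normal_closure_def)

lemma commutator_closed:
  assumes "group G" "x \<in> carrier G" "y \<in> carrier G"
  shows "commutator G x y \<in> carrier G"
proof -
  interpret group G by fact
  show ?thesis using assms(2,3) by (simp add: commutator_def)
qed

lemma N2_law_values_closed:
  assumes "group G"
  shows "N2_law_values p G \<subseteq> carrier G"
proof -
  interpret group G by fact
  show ?thesis by (auto simp: N2_law_values_def commutator_closed)
qed

lemma hom_commutator:
  assumes "group_hom G H h" "x \<in> carrier G" "y \<in> carrier G"
  shows "h (commutator G x y) = commutator H (h x) (h y)"
proof -
  interpret group_hom G H h by fact
  show ?thesis using assms(2,3) by (simp add: commutator_def)
qed

lemma N2_law_values_hom:
  assumes "group_hom G H h"
  shows "h ` N2_law_values p G \<subseteq> N2_law_values p H"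
proof -
  interpret group_hom G H h by fact
  show ?thesis
    unfolding N2_law_values_def
    using hom_commutator[OF assms] commutator_closed[OF G.group_axioms] hom_nat_pow
    by (fastforce simp: image_iff)
qed

lemma N2_law_values_surj_hom:
  assumes "group_hom G H h" "h ` carrier G = carrier H"
  shows "N2_law_values p H \<subseteq> h ` N2_law_values p G"
proof
  interpret group_hom G H h by fact
  fix v assume "v \<in> N2_law_values p H"
  then consider
    x y z where "x \<in> carrier G" "y \<in> carrier G" "z \<in> carrier G"
      "v = commutator H (commutator H (h x) (h y)) (h z)"
  | x where "x \<in> carrier G" "v = h x [^]\<^bsub>H\<^esub> p"
    unfolding N2_law_values_def assms(2)[symmetric] by blast
  then show "v \<in> h ` N2_law_values p G"
  proof cases
    case 1
    then have "v = h (commutator G (commutator G x y) z)"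
      by (simp add: hom_commutator[OF assms(1)] commutator_closed)
    with 1 show ?thesis unfolding N2_law_values_def by blast
  next
    case 2
    then have "v = h (x [^]\<^bsub>G\<^esub> p)" by (simp add: hom_nat_pow)
    with 2 show ?thesis unfolding N2_law_values_def by blast
  qed
qed

lemma group_hom_Mod:
  assumes "N \<lhd> G"
  shows "group_hom G (G Mod N) (\<lambda>x. N #>\<^bsub>G\<^esub> x)"
  using assms normal.r_coset_hom_Mod[OF assms] normal.factorgroup_is_group[OF assms]
  by (simp add: group_hom_def group_hom_axioms_def normal_def)

lemma in_N2_Mod:
  assumes "N \<lhd> G" "N2_law_values p G \<subseteq> N"
  shows "in_N2 p (G Mod N)"
proof -
  interpret N: normal N G by fact
  have "(\<lambda>x. N #>\<^bsub>G\<^esub> x) ` N2_law_values p G \<subseteq> {N}"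
    using assms(2) N.rcos_const by auto
  moreover have "N2_law_values p (G Mod N) \<subseteq> (\<lambda>x. N #>\<^bsub>G\<^esub> x) ` N2_law_values p G"
    by (rule N2_law_values_surj_hom[OF group_hom_Mod[OF assms(1)]]) (simp add: carrier_FactGroup)
  ultimately show ?thesis
    by (auto simp: in_N2_def N.factorgroup_is_group)
qed

lemma N2_verbal_normal: "N2_verbal p \<lhd> free_group"
  unfolding N2_verbal_def
  by (intro normal_normal_closure N2_law_values_closed group_free_group)

lemma free_N2_in_N2: "in_N2 p (free_N2 p)"
  unfolding free_N2_def
  by (rule in_N2_Mod[OF N2_verbal_normal]) (simp add: N2_verbal_def normal_closure_incl)

lemma group_free_N2: "group (free_N2 p)"
  using free_N2_in_N2 unfolding in_N2_def by (rule conjunct1)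

lemma gen_N2_closed: "gen_N2 p a \<in> carrier (free_N2 p)"
  by (auto simp: gen_N2_def free_N2_def carrier_FactGroup free_group_carrier)

lemma free_group_universal:
  assumes "group H" and f: "range f \<subseteq> carrier H"
  shows "\<exists>h \<in> hom free_group H. \<forall>a. h (word_rel `` {[(a, True)]}) = f a"
proof -
  interpret group H by fact
  define l where "l = (\<lambda>(a, s). if s then f a else inv\<^bsub>H\<^esub> (f a))"
  define ev where "ev = (\<lambda>w. foldr (\<lambda>b x. l b \<otimes>\<^bsub>H\<^esub> x) w \<one>\<^bsub>H\<^esub>)"
  have fc: "f a \<in> carrier H" for a using f by auto
  have lc: "l b \<in> carrier H" for b using fc by (auto simp: l_def split: prod.splits)
  have evc: "ev w \<in> carrier H" for w by (induction w) (auto simp: ev_def lc)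
  have ev_Cons: "ev (b # w) = l b \<otimes>\<^bsub>H\<^esub> ev w" for b w by (simp add: ev_def)
  have ev_app: "ev (u @ v) = ev u \<otimes>\<^bsub>H\<^esub> ev v" for u v
  proof (induction u)
    case Nil
    then show ?case using evc[of v] by (simp add: ev_def)
  next
    case (Cons b u)
    then show ?case by (simp add: ev_Cons m_assoc lc evc)
  qed
  have "l (a, s) \<otimes>\<^bsub>H\<^esub> (l (a, \<not> s) \<otimes>\<^bsub>H\<^esub> x) = x" if "x \<in> carrier H" for a s x
    using that fc by (cases s) (simp_all add: l_def flip: m_assoc)
  then have ev_cancels: "cancels u v \<Longrightarrow> ev u = ev v" for u v
    by (auto elim!: cancels.cases simp: ev_app ev_Cons evc)
  have ev_rel: "ev u = ev v" if "(u, v) \<in> word_rel" for u v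
  proof -
    have "equivclp cancels u v" using that by (simp add: word_rel_def)
    then show ?thesis by (induction rule: equivclp_induct) (auto dest: ev_cancels)
  qed
  define h where "h = (\<lambda>A. ev (SOME w. w \<in> A))"
  have h: "h (word_rel `` {w}) = ev w" for w
  proof -
    have "(SOME v. v \<in> word_rel `` {w}) \<in> word_rel `` {w}"
      by (rule someI[of _ w]) (simp add: word_rel_def)
    then show ?thesis unfolding h_def using ev_rel[of w] by auto
  qed
  have "h \<in> hom free_group H"
    by (rule homI) (auto simp: free_group_carrier free_group_mult h evc ev_app)
  moreover have "h (word_rel `` {[(a, True)]}) = f a" for a
    using fc by (simp add: h ev_def l_def)
  ultimately show ?thesis by blast
qed

lemma free_N2_universal:
  assumes H: "in_N2 p H" and f: "range f \<subseteq> carrier H"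
  shows "\<exists>h \<in> hom (free_N2 p) H. \<forall>a. h (gen_N2 p a) = f a"
proof -
  have "group H" using H by (simp add: in_N2_def)
  from free_group_universal[OF this f] obtain h where
    h: "h \<in> hom free_group H" "\<And>a. h (word_rel `` {[(a, True)]}) = f a" by blast
  interpret h: group_hom free_group H h
    by (simp add: group_hom_def group_hom_axioms_def \<open>group H\<close> group_free_group h(1))
  have "h ` N2_law_values p free_group \<subseteq> {\<one>\<^bsub>H\<^esub>}"
    using N2_law_values_hom[OF h.group_hom_axioms] H unfolding in_N2_def by blast
  then have "N2_law_values p free_group \<subseteq> kernel free_group H h"
    using N2_law_values_closed[OF group_free_group] by (auto simp: kernel_def)
  then have "N2_verbal p \<subseteq> kernel free_group H h"
    unfolding N2_verbal_def by (intro normal_closure_least h.normal_kernel)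
  from h.FactGroup_universal_kernel[OF N2_verbal_normal this] obtain g where
    g: "g \<in> hom (free_group Mod N2_verbal p) H"
       "\<And>x. x \<in> carrier free_group \<Longrightarrow> g (N2_verbal p #>\<^bsub>free_group\<^esub> x) = h x" by blast
  have "g (gen_N2 p a) = f a" for a
    using g(2) h(2) by (auto simp: gen_N2_def free_group_carrier)
  then show ?thesis using g(1) by (auto simp: free_N2_def)
qed

lemma group_presented_N2:
  assumes "R \<subseteq> carrier (free_N2 p) \<times> carrier (free_N2 p)"
  shows "group (presented_N2 p R)"
proof -
  interpret group "free_N2 p" by (rule group_free_N2)
  show ?thesis
    unfolding presented_N2_def
    by (intro normal.factorgroup_is_group normal_normal_closure group_free_N2)
      (use assms in auto)
qed

lemma group_group_E: "group (group_E p)"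
  unfolding group_E_def
  by (rule group_presented_N2)
    (auto simp: E_relations_def intro: commutator_closed group_free_N2 gen_N2_closed)

end

theory Submission
  imports Defs "HOL-Computational_Algebra.Polynomial"
begin

text \<open>In \<open>E\<close> the element \<open>z\<close> is central and, for \<open>i < k\<close>, \<open>x\<^sub>k ^ a * x\<^sub>i ^ b = x\<^sub>i ^ b * x\<^sub>k ^ a * z ^ (- a b)\<close>,
  so every element is a product of the \<open>x\<^sub>i ^ f i\<close> in increasing order of \<open>i\<close>, times \<open>z ^ c\<close>, and
  the product of \<open>(f, c)\<close> and \<open>(g, d)\<close> is \<open>(f + g, c + d - B f g)\<close>, where \<open>B f g\<close> is the sum of
  \<open>f k * g i\<close> over \<open>i < k\<close>.  Pairs of integral exponents with this product form a group, whose
  quotient modulo \<open>p\<close> lies in the variety because \<open>p\<close> is odd; hence the exponents are unique modulo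
  \<open>p\<close>.  If \<open>f\<close>, \<open>g\<close> are read digit by digit, then \<open>B f g\<close> modulo \<open>p\<close> is computed by a finite automaton
  that remembers the sum of the digits of \<open>g\<close> read so far.\<close>

section \<open>Regular languages of convolutions\<close>

text \<open>\<open>regular_over\<close> asks for numbered states; an injection \<open>e\<close> of
  the finite set \<open>Q\<close> transports an automaton with states of any type. Runs stay in
  \<open>Q\<close>, so only \<open>F \<inter> Q\<close> matters.\<close>

lemma regular_overI:
  fixes Q :: "'q set" and \<delta> :: "'q \<Rightarrow> 'a \<Rightarrow> 'q"
  assumes "finite Q" "q0 \<in> Q" and closed: "\<And>q a. q \<in> Q \<Longrightarrow> a \<in> A \<Longrightarrow> \<delta> q a \<in> Q"
  shows "regular_over A {w \<in> lists A. foldl \<delta> q0 w \<in> F}"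
proof -
  obtain e :: "'q \<Rightarrow> nat" where e: "inj_on e Q"
    using assms(1) finite_imp_inj_to_nat_seg by blast
  define \<delta>' where "\<delta>' = (\<lambda>m a. e (\<delta> (inv_into Q e m) a))"
  have run: "foldl \<delta> q w \<in> Q \<and> foldl \<delta>' (e q) w = e (foldl \<delta> q w)"
    if "w \<in> lists A" "q \<in> Q" for q w
    using that by (induction w arbitrary: q) (auto simp: \<delta>'_def closed e)
  have "{w \<in> lists A. foldl \<delta> q0 w \<in> F} = {w \<in> lists A. foldl \<delta>' (e q0) w \<in> e ` (F \<inter> Q)}"
  proof -
    have "e (foldl \<delta> q0 w) \<in> e ` (F \<inter> Q) \<longleftrightarrow> foldl \<delta> q0 w \<in> F" if "w \<in> lists A" for w
      using run[OF that assms(2)] inj_on_image_mem_iff[OF e, of _ "F \<inter> Q"] by blast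
    then show ?thesis using run[OF _ assms(2)] by (intro Collect_cong conj_cong refl) simp
  qed
  moreover have "\<forall>m\<in>e ` Q. \<forall>a\<in>A. \<delta>' m a \<in> e ` Q"
    by (auto simp: \<delta>'_def closed e)
  ultimately show ?thesis
    unfolding regular_over_def using assms(1,2)
    by (intro exI[of _ "e ` Q"] exI[of _ "e q0"] exI[of _ \<delta>'] exI[of _ "e ` (F \<inter> Q)"]) auto
qed

lemma regular_over_lists: "regular_over A (lists A)"
  using regular_overI[of "{()}" "()" A "\<lambda>_ _. ()" UNIV] by simp

text \<open>The product automaton runs both automata side by side.\<close>

lemma regular_over_Int:
  assumes "regular_over A L" "regular_over A M"
  shows "regular_over A (L \<inter> M)"
proof -
  obtain Q q0 \<delta> F where L: "finite (Q :: nat set)" "q0 \<in> Q" "\<forall>q\<in>Q. \<forall>a\<in>A. \<delta> q a \<in> Q"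
    "L = {w \<in> lists A. foldl \<delta> q0 w \<in> F}"
    using assms(1) unfolding regular_over_def by blast
  obtain Q' q0' \<delta>' F' where M: "finite (Q' :: nat set)" "q0' \<in> Q'" "\<forall>q\<in>Q'. \<forall>a\<in>A. \<delta>' q a \<in> Q'"
    "M = {w \<in> lists A. foldl \<delta>' q0' w \<in> F'}"
    using assms(2) unfolding regular_over_def by blast
  let ?d = "\<lambda>(q, q') a. (\<delta> q a, \<delta>' q' a)"
  have run: "foldl ?d (q, q') w = (foldl \<delta> q w, foldl \<delta>' q' w)" for q q' w
    by (induction w arbitrary: q q') auto
  have "regular_over A {w \<in> lists A. foldl ?d (q0, q0') w \<in> F \<times> F'}"
    by (rule regular_overI[of "Q \<times> Q'"]) (use L M in auto)
  also have "{w \<in> lists A. foldl ?d (q0, q0') w \<in> F \<times> F'} = L \<inter> M"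
    by (auto simp: L(4) M(4) run)
  finally show ?thesis .
qed

section \<open>Convolutions read column by column\<close>

lemma less_Max_length_iff:
  "ws \<noteq> [] \<Longrightarrow> j < Max (length ` set ws) \<longleftrightarrow> (\<exists>w\<in>set ws. j < length w)"
  by (subst Max_gr_iff) auto

lemma convolution_eq_Nil: "ws \<noteq> [] \<Longrightarrow> convolution ws = [] \<longleftrightarrow> (\<forall>w\<in>set ws. w = [])"
  using less_Max_length_iff[of ws 0] by (auto simp: convolution_def)

text \<open>Turns the indexed definition into a recursion on columns, so that runs can be studied by
  induction. Since \<open>tl [] = []\<close>, a row that has ended keeps supplying fillers.\<close>

lemma convolution_rec:
  assumes "\<exists>w\<in>set ws. w \<noteq> []"
  shows "convolution ws =
    map (\<lambda>w. case w of [] \<Rightarrow> None | a # _ \<Rightarrow> Some a) ws # convolution (map tl ws)"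
proof -
  let ?n = "Max (length ` set ws)" and ?m = "Max (length ` set (map tl ws))"
  have ne: "ws \<noteq> []" using assms by auto
  have "j < ?n \<longleftrightarrow> j < Suc ?m" for j
  proof (cases j)
    case 0
    then show ?thesis using less_Max_length_iff[OF ne, of 0] assms by auto
  next
    case (Suc i)
    have "i < ?m \<longleftrightarrow> (\<exists>w\<in>set ws. i < length (tl w))"
      using less_Max_length_iff[of "map tl ws" i] ne by auto
    then show ?thesis using less_Max_length_iff[OF ne, of j] Suc by (auto simp: less_diff_conv)
  qed
  from this[of "Suc ?m"] this[of ?n] this[of ?m] have "?n = Suc ?m" by simp
  then have "[0..<?n] = 0 # map Suc [0..<?m]"
    by (simp add: map_Suc_upt upt_conv_Cons del: upt_Suc)
  then show ?thesis
    by (auto simp: convolution_def nth_tl hd_conv_nth split: list.splits)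
qed

lemma convolution_in_columns:
  assumes "length ws = n" "set ws \<subseteq> lists A"
  shows "convolution ws \<in> lists (columns n A)"
  using assms by (auto simp: convolution_def columns_def subset_iff in_lists_conv_set)

text \<open>An automaton for the words over columns that are convolutions: its state is the set of rows
  that have ended, or \<open>None\<close> after a row has been resumed or a column consisted of fillers only.\<close>

definition filler_step :: "nat \<Rightarrow> nat set option \<Rightarrow> 'a option list \<Rightarrow> nat set option" where
  "filler_step n s c = (case s of None \<Rightarrow> None | Some D \<Rightarrow>
     let D' = {i. i < n \<and> c ! i = None} in if D \<subseteq> D' \<and> D' \<noteq> {..<n} then Some D' else None)"

lemma foldl_filler_step_None [simp]: "foldl (filler_step n) None w = None"
  by (induction w) (auto simp: filler_step_def)

text \<open>Ended rows stay empty, so the set in the state only grows, and every column meets a row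
  that has not ended. \<open>D\<close> is a parameter because the induction restarts in the middle
  of a run.\<close>

lemma filler_run_convolution:
  assumes "length ws = n" "0 < n" "D \<subseteq> {i. i < n \<and> ws ! i = []}"
  shows "foldl (filler_step n) (Some D) (convolution ws) \<noteq> None"
  using assms
proof (induction "convolution ws" arbitrary: ws D)
  case Nil
  then show ?case by simp
next
  case (Cons c cs)
  let ?D = "{i. i < n \<and> ws ! i = []}"
  have ne: "\<exists>w\<in>set ws. w \<noteq> []"
    using Cons.hyps(2) Cons.prems convolution_eq_Nil[of ws] by auto
  then have eq: "c = map (\<lambda>w. case w of [] \<Rightarrow> None | a # _ \<Rightarrow> Some a) ws"
    "cs = convolution (map tl ws)"
    using convolution_rec[of ws] Cons.hyps(2) by auto
  have D: "{i. i < n \<and> c ! i = None} = ?D"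
    using Cons.prems(1) by (auto simp: eq(1) split: list.splits)
  obtain i where "i < n" "ws ! i \<noteq> []" using ne Cons.prems(1) by (metis in_set_conv_nth)
  then have "i \<in> {..<n} - ?D" by simp
  then have "?D \<noteq> {..<n}" by blast
  then have "filler_step n (Some D) c = Some ?D"
    using Cons.prems(3) by (simp add: filler_step_def D)
  moreover have "foldl (filler_step n) (Some ?D) cs \<noteq> None"
    unfolding eq(2) by (rule Cons.hyps(1)[OF eq(2)]) (use Cons.prems in auto)
  ultimately show ?case by (simp flip: Cons.hyps(2))
qed

text \<open>The rows are rebuilt from the last column to the first. The condition on
  \<open>D\<close> serves the induction: rows that ended before \<open>w\<close> is read must
  contribute nothing to it.\<close>

lemma filler_run_imp_convolution:
  assumes "w \<in> lists (columns n A)" "0 < n" "D \<subseteq> {..<n}"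
    and "foldl (filler_step n) (Some D) w \<noteq> None"
  shows "\<exists>ws. length ws = n \<and> set ws \<subseteq> lists A \<and> (\<forall>i\<in>D. ws ! i = []) \<and> convolution ws = w"
  using assms(1,3,4)
proof (induction w arbitrary: D rule: list.induct)
  case Nil
  have "convolution (replicate n []) = []"
    using assms(2) by (subst convolution_eq_Nil) auto
  with Nil show ?case by (intro exI[of _ "replicate n []"]) auto
next
  case (Cons c w)
  let ?D = "{i. i < n \<and> c ! i = None}"
  have c: "length c = n" "set c \<subseteq> insert None (Some ` A)"
    using Cons.prems(1) by (simp_all add: columns_def)
  have "filler_step n (Some D) c \<noteq> None"
    using Cons.prems(3) by (metis foldl_Cons foldl_filler_step_None)
  then have D: "D \<subseteq> ?D" "?D \<noteq> {..<n}" and step: "filler_step n (Some D) c = Some ?D"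
    by (simp_all add: filler_step_def Let_def split: if_split_asm)
  have run: "foldl (filler_step n) (Some ?D) w \<noteq> None"
    using Cons.prems(3) step by simp
  obtain vs where vs: "length vs = n" "set vs \<subseteq> lists A" "\<forall>i\<in>?D. vs ! i = []"
    "convolution vs = w"
    using Cons.IH[OF _ _ run] Cons.prems(1) by auto
  \<comment> \<open>A row with a filler in \<open>c\<close> lies in \<open>?D\<close>, so its
    remainder in \<open>vs\<close> is empty; starting it as \<open>[]\<close> therefore still gives
    \<open>map tl ws = vs\<close>.\<close>
  define ws where
    "ws = map (\<lambda>i. case c ! i of None \<Rightarrow> [] | Some a \<Rightarrow> a # vs ! i) [0..<n]"
  have tl: "map tl ws = vs"
    by (rule nth_equalityI) (use vs(1,3) in \<open>auto simp: ws_def split: option.splits\<close>)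
  have hd: "map (\<lambda>w. case w of [] \<Rightarrow> None | a # _ \<Rightarrow> Some a) ws = c"
    by (rule nth_equalityI) (use c(1) in \<open>auto simp: ws_def split: option.splits\<close>)
  have "\<exists>i<n. c ! i \<noteq> None" using D(2) by auto
  then have "\<exists>w\<in>set ws. w \<noteq> []" by (force simp: ws_def split: option.splits)
  from convolution_rec[OF this] have "convolution ws = c # w" by (simp add: tl hd vs(4))
  moreover have "set ws \<subseteq> lists A"
  proof -
    have "c ! i = Some a \<Longrightarrow> a \<in> A" if "i < n" for i a
      using that c nth_mem[of i c] by auto
    moreover have "vs ! i \<in> lists A" if "i < n" for i
      using that vs(1,2) nth_mem[of i vs] by blast
    ultimately show ?thesis by (fastforce simp: ws_def split: option.splits)
  qed
  moreover have "\<forall>i\<in>D. ws ! i = []" using D(1) by (auto simp: ws_def)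
  ultimately show ?case by (intro exI[of _ ws]) (auto simp: ws_def)
qed

lemma regular_over_convolutions:
  assumes "0 < n"
  shows "regular_over (columns n A) (convolution ` {ws. length ws = n \<and> set ws \<subseteq> lists A})"
proof -
  have "convolution ` {ws. length ws = n \<and> set ws \<subseteq> lists A}
    = {w \<in> lists (columns n A). foldl (filler_step n) (Some {}) w \<in> - {None}}"
  proof (intro equalityI subsetI)
    fix w assume "w \<in> convolution ` {ws. length ws = n \<and> set ws \<subseteq> lists A}"
    then obtain ws where "length ws = n" "set ws \<subseteq> lists A" "w = convolution ws" by blast
    then show "w \<in> {w \<in> lists (columns n A). foldl (filler_step n) (Some {}) w \<in> - {None}}"
      using assms convolution_in_columns[of ws n A] filler_run_convolution[of ws n "{}"] by auto
  next
    fix w assume "w \<in> {w \<in> lists (columns n A). foldl (filler_step n) (Some {}) w \<in> - {None}}"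
    then show "w \<in> convolution ` {ws. length ws = n \<and> set ws \<subseteq> lists A}"
      using assms filler_run_imp_convolution[of w n A "{}"] by blast
  qed
  moreover have "regular_over (columns n A)
      {w \<in> lists (columns n A). foldl (filler_step n) (Some {}) w \<in> - {None}}"
    by (rule regular_overI[of "insert None (Some ` Pow {..<n})"])
      (auto simp: filler_step_def Let_def split: option.splits)
  ultimately show ?thesis by simp
qed

text \<open>Intersecting with the language of all convolutions means that it does not matter which
  other words over columns are accepted through \<open>\<delta>\<close>.\<close>

lemma FA_recognizableI:
  fixes Q :: "'q set" and \<delta> :: "'q \<Rightarrow> 'a option list \<Rightarrow> 'q"
  assumes "0 < n" "finite Q" "q0 \<in> Q"
    and "\<And>q c. q \<in> Q \<Longrightarrow> c \<in> columns n A \<Longrightarrow> \<delta> q c \<in> Q"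
  shows "FA_recognizable n A
    {ws. length ws = n \<and> set ws \<subseteq> lists A \<and> foldl \<delta> q0 (convolution ws) \<in> F}"
proof -
  have "convolution ` {ws. length ws = n \<and> set ws \<subseteq> lists A \<and> foldl \<delta> q0 (convolution ws) \<in> F}
    = convolution ` {ws. length ws = n \<and> set ws \<subseteq> lists A}
      \<inter> {w \<in> lists (columns n A). foldl \<delta> q0 w \<in> F}"
    using convolution_in_columns[of _ n A] by auto
  then show ?thesis
    using regular_over_Int[OF regular_over_convolutions[OF assms(1)] regular_overI[OF assms(2-4)]]
    by (simp add: FA_recognizable_def)
qed

section \<open>A Heisenberg group of infinite rank\<close>

text \<open>The form \<open>B\<close> cut off at \<open>n\<close>. It takes functions, so that it
  applies to coefficients and to the digits read by the automaton alike.\<close>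

definition form_upto :: "nat \<Rightarrow> (nat \<Rightarrow> int) \<Rightarrow> (nat \<Rightarrow> int) \<Rightarrow> int" where
  "form_upto n f g = (\<Sum>k<n. f k * (\<Sum>i<k. g i))"

lemma form_upto_mono:
  assumes "m \<le> n" "\<And>i. m \<le> i \<Longrightarrow> f i = 0"
  shows "form_upto m f g = form_upto n f g"
  unfolding form_upto_def using assms by (intro sum.mono_neutral_left) auto

definition form :: "int poly \<Rightarrow> int poly \<Rightarrow> int" where
  "form f g = form_upto (Suc (degree f)) (coeff f) (coeff g)"

text \<open>Summands beyond the support of \<open>f\<close> vanish, so any bound on the support may
  replace the degree; several polynomials can then share one bound.\<close>

lemma form_eq_upto:
  assumes "\<And>i. n \<le> i \<Longrightarrow> coeff f i = 0"
  shows "form f g = form_upto n (coeff f) (coeff g)"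
proof -
  let ?m = "max n (Suc (degree f))"
  have "form f g = form_upto ?m (coeff f) (coeff g)"
    unfolding form_def by (rule form_upto_mono) (auto simp: coeff_eq_0)
  also have "\<dots> = form_upto n (coeff f) (coeff g)"
    by (rule form_upto_mono[symmetric]) (auto simp: assms)
  finally show ?thesis .
qed

lemma form_add_left: "form (f + f') g = form f g + form f' g"
proof -
  let ?n = "Suc (max (degree f) (degree f'))"
  show ?thesis
    by (simp add: form_eq_upto[of ?n] form_upto_def coeff_eq_0 distrib_right sum.distrib
        del: sum.lessThan_Suc)
qed

lemma form_add_right: "form f (g + g') = form f g + form f g'"
  by (simp add: form_def form_upto_def distrib_left sum.distrib del: sum.lessThan_Suc)

lemma form_zero_left [simp]: "form 0 g = 0"
  by (simp add: form_def form_upto_def)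

lemma form_zero_right [simp]: "form f 0 = 0"
  by (simp add: form_def form_upto_def)

lemma form_uminus_left [simp]: "form (- f) g = - form f g"
  using form_add_left[of f "- f" g] by simp

lemma form_uminus_right [simp]: "form f (- g) = - form f g"
  using form_add_right[of f g "- g"] by simp

lemma form_diff_left: "form (f - f') g = form f g - form f' g"
  using form_add_left[of f "- f'" g] by simp

lemma form_smult_left: "form (smult a f) g = a * form f g"
  by (simp add: form_eq_upto[of "Suc (degree f)"] form_upto_def coeff_eq_0 sum_distrib_left
      mult.assoc del: sum.lessThan_Suc)

lemma form_monom: "form (monom a k) (monom b i) = (if i < k then a * b else 0)"
proof -
  have "form (monom a k) (monom b i) = (\<Sum>l<Suc k. if k = l then a * (\<Sum>j<l. if i = j then b else 0) else 0)"
    by (subst form_eq_upto[of "Suc k"], simp, unfold form_upto_def coeff_monom, intro sum.cong refl) simp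
  then show ?thesis by (simp del: sum.lessThan_Suc)
qed

lemma dvd_form_left: "(\<And>i. d dvd coeff f i) \<Longrightarrow> d dvd form f g"
  by (simp add: form_def form_upto_def dvd_sum dvd_mult2 del: sum.lessThan_Suc)

lemma dvd_form_right: "(\<And>i. d dvd coeff g i) \<Longrightarrow> d dvd form f g"
  by (simp add: form_def form_upto_def dvd_sum dvd_mult del: sum.lessThan_Suc)

text \<open>The pair \<open>(f, c)\<close> stands for the product of the \<open>x\<^sub>i ^ coeff f i\<close> in increasing order
  of \<open>i\<close>, times \<open>z ^ c\<close>.  Exponents are integers here; they are reduced modulo \<open>p\<close> by passing
  to the quotient by \<open>heis_mod p\<close>.\<close>

definition heis :: "(int poly \<times> int) monoid" where
  "heis = \<lparr>carrier = UNIV, monoid.mult = (\<lambda>(f, c) (g, d). (f + g, c + d - form f g)), one = (0, 0)\<rparr>"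

lemma carrier_heis [simp]: "carrier heis = UNIV"
  and mult_heis [simp]: "(f, c) \<otimes>\<^bsub>heis\<^esub> (g, d) = (f + g, c + d - form f g)"
  and one_heis [simp]: "\<one>\<^bsub>heis\<^esub> = (0, 0)"
  by (simp_all add: heis_def)

text \<open>A bilinear map is a 2-cocycle: associativity comes from additivity of
  \<open>form\<close> in each argument.\<close>

lemma group_heis: "group heis"
proof (rule groupI)
  fix a assume "a \<in> carrier heis"
  obtain f c where "a = (f, c)" by (cases a)
  then have "(- f, - c - form f f) \<otimes>\<^bsub>heis\<^esub> a = \<one>\<^bsub>heis\<^esub>" by simp
  then show "\<exists>b\<in>carrier heis. b \<otimes>\<^bsub>heis\<^esub> a = \<one>\<^bsub>heis\<^esub>" by auto
qed (auto simp: form_add_left form_add_right)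

lemma inv_heis [simp]: "inv\<^bsub>heis\<^esub> (f, c) = (- f, - c - form f f)"
  by (rule group.inv_equality[OF group_heis]) auto

text \<open>The antisymmetrized form. It yields the law of class 2, because pairs with first
  component 0 are central, and, with \<open>form_monom\<close>, the defining relations.\<close>

lemma commutator_heis: "commutator heis (f, c) (g, d) = (0, form g f - form f g)"
  by (simp add: commutator_def form_add_left form_add_right form_diff_left)

text \<open>Multiplying the \<open>k\<close>-th power by one more factor subtracts \<open>k\<close>
  times \<open>form f f\<close>; these weights add up to the triangular number
  \<open>\<Sum>{..<n}\<close>.\<close>

lemma nat_pow_heis:
  "(f, c) [^]\<^bsub>heis\<^esub> n = (smult (int n) f, int n * c - int (\<Sum>{..<n}) * form f f)"
  by (induction n) (auto simp: form_smult_left algebra_simps smult_add_left)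

definition heis_mod :: "nat \<Rightarrow> (int poly \<times> int) set" where
  "heis_mod p = {(f, c). (\<forall>i. int p dvd coeff f i) \<and> int p dvd c}"

lemma normal_heis_mod: "heis_mod p \<lhd> heis"
proof (rule group.normal_invI[OF group_heis])
  show "subgroup (heis_mod p) heis"
    by (rule group.subgroupI[OF group_heis])
      (auto simp: heis_mod_def intro!: dvd_form_left dvd_diff intro: exI[of _ 0])
next
  fix a h assume "a \<in> heis_mod p" 
  then show "h \<otimes>\<^bsub>heis\<^esub> a \<otimes>\<^bsub>heis\<^esub> inv\<^bsub>heis\<^esub> h \<in> heis_mod p"
    by (cases a; cases h)
      (auto simp: heis_mod_def form_add_left form_add_right dvd_form_left dvd_form_right)
qed

text \<open>A member \<open>(u, e)\<close> of \<open>heis_mod p\<close> shifts exponents by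
  multiples of \<open>p\<close> only, since the correction \<open>form u g\<close> is one as well.
  This will make normal forms unique modulo \<open>p\<close>.\<close>

lemma rcoset_heis_mod_eq:
  assumes "heis_mod p #>\<^bsub>heis\<^esub> (f, c) = heis_mod p #>\<^bsub>heis\<^esub> (g, d)"
  shows "int p dvd coeff f i - coeff g i" "int p dvd c - d"
proof -
  have "(f, c) \<in> heis_mod p #>\<^bsub>heis\<^esub> (g, d)"
    using assms group.rcos_self[OF group_heis, of "(f, c)" "heis_mod p"]
      normal_imp_subgroup[OF normal_heis_mod] by auto
  then obtain u e where ue: "(u, e) \<in> heis_mod p" "(f, c) = (u, e) \<otimes>\<^bsub>heis\<^esub> (g, d)"
    by (auto simp: r_coset_def)
  then have "int p dvd form u g" by (auto simp: heis_mod_def intro: dvd_form_left)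
  with ue show "int p dvd coeff f i - coeff g i" "int p dvd c - d"
    by (auto simp: heis_mod_def)
qed

lemma N2_law_values_heis:
  assumes "odd p"
  shows "N2_law_values p heis \<subseteq> heis_mod p"
proof -
  \<comment> \<open>Oddness enters here: the weight of \<open>form f f\<close> in a
    \<open>p\<close>-th power is half of \<open>p * (p - 1)\<close>, and it is divisible by
    \<open>p\<close> because \<open>p\<close> is coprime to 2.\<close>
  have "2 * \<Sum>{..<p} = p * (p - 1)" by (induction p) (auto simp: algebra_simps)
  then have "p dvd \<Sum>{..<p} * 2" by (metis dvd_triv_left mult.commute)
  then have "p dvd \<Sum>{..<p}"
    using assms coprime_dvd_mult_left_iff[of p 2] by (simp add: coprime_right_2_iff_odd)
  then have "int p dvd int (\<Sum>{..<p})" by (simp only: of_nat_dvd_iff)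
  then have "(f, c) [^]\<^bsub>heis\<^esub> p \<in> heis_mod p" for f c
    by (simp only: nat_pow_heis heis_mod_def) (simp del: of_nat_sum)
  moreover have "commutator heis (commutator heis x y) w \<in> heis_mod p" for x y w
    by (cases x; cases y; cases w) (simp add: commutator_heis heis_mod_def)
  ultimately show ?thesis by (auto simp: N2_law_values_def)
qed

lemma in_N2_heis: "odd p \<Longrightarrow> in_N2 p (heis Mod heis_mod p)"
  by (intro in_N2_Mod normal_heis_mod N2_law_values_heis)

section \<open>Normal forms\<close>

context group
begin

lemma inv_mult_cancel:
  assumes "a \<in> carrier G" "b \<in> carrier G"
  shows "inv a \<otimes> (a \<otimes> b) = b" "a \<otimes> (inv a \<otimes> b) = b"
  using assms by (simp_all flip: m_assoc)

lemma commutator_swap: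
  assumes "a \<in> carrier G" "b \<in> carrier G"
  shows "a \<otimes> b = b \<otimes> a \<otimes> commutator G a b"
  using assms by (simp add: commutator_def m_assoc inv_mult_cancel)

lemma int_pow_commute:
  assumes "c \<in> carrier G" "w \<in> carrier G" "c \<otimes> w = w \<otimes> c"
  shows "c [^] (n::int) \<otimes> w = w \<otimes> c [^] n"
proof -
  have pow: "c [^] m \<otimes> w = w \<otimes> c [^] m" for m :: nat
    using assms by (intro group_commutes_pow) auto
  have "inv (c [^] m) \<otimes> w = w \<otimes> inv (c [^] m)" for m :: nat
  proof -
    let ?a = "c [^] m"
    have "inv ?a \<otimes> w = inv ?a \<otimes> (w \<otimes> ?a) \<otimes> inv ?a"
      using assms by (simp add: m_assoc)
    also have "\<dots> = w \<otimes> inv ?a"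
      using assms by (simp add: m_assoc inv_mult_cancel flip: pow)
    finally show ?thesis .
  qed
  with pow show ?thesis
    by (cases n rule: int_cases2) (simp_all add: assms(1) int_pow_neg_int int_pow_int)
qed

text \<open>Conjugation by \<open>a\<close> is a homomorphism taking \<open>b\<close> to
  \<open>b \<otimes> c\<close>, hence \<open>b [^] n\<close> to
  \<open>b [^] n \<otimes> c [^] n\<close>, as \<open>c\<close> is central.\<close>

lemma int_pow_swap_right:
  assumes closed [simp]: "a \<in> carrier G" "b \<in> carrier G" "c \<in> carrier G"
    and central: "\<And>w. w \<in> carrier G \<Longrightarrow> c \<otimes> w = w \<otimes> c"
    and swap: "a \<otimes> b = b \<otimes> a \<otimes> c"
  shows "a \<otimes> b [^] (n::int) = b [^] n \<otimes> a \<otimes> c [^] n"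
proof -
  let ?h = "\<lambda>w. a \<otimes> w \<otimes> inv a"
  have "?h \<in> hom G G" by (auto simp: hom_def m_assoc inv_mult_cancel)
  then interpret h: group_hom G G ?h by (simp add: group_hom_def group_hom_axioms_def)
  have hb: "?h b = b \<otimes> c"
    by (simp add: swap m_assoc central[of "inv a"] inv_mult_cancel)
  have "a \<otimes> b [^] n = ?h (b [^] n) \<otimes> a" by (simp add: m_assoc)
  also have "?h (b [^] n) = (b \<otimes> c) [^] n" by (simp add: h.hom_int_pow hb)
  also have "\<dots> = b [^] n \<otimes> c [^] n" by (simp add: int_pow_mult_distrib central)
  also have "\<dots> \<otimes> a = b [^] n \<otimes> a \<otimes> c [^] n"
    using int_pow_commute[of c a n] by (simp add: m_assoc central)
  finally show ?thesis .
qed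

text \<open>\<open>int_pow_swap_right\<close> is applied twice: to pass \<open>a\<close> across a
  power of \<open>b\<close>, and then, with roles exchanged, to pass \<open>b [^] n\<close> across a
  power of \<open>a\<close>, with central factor \<open>inv (c [^] n)\<close>.\<close>

lemma int_pow_swap:
  assumes closed [simp]: "a \<in> carrier G" "b \<in> carrier G" "c \<in> carrier G"
    and central: "\<And>w. w \<in> carrier G \<Longrightarrow> c \<otimes> w = w \<otimes> c"
    and swap: "a \<otimes> b = b \<otimes> a \<otimes> c"
  shows "a [^] (m::int) \<otimes> b [^] (n::int) = b [^] n \<otimes> a [^] m \<otimes> c [^] (m * n)"
proof -
  let ?d = "c [^] n"
  have d_central: "inv ?d \<otimes> w = w \<otimes> inv ?d" if "w \<in> carrier G" for w
    using int_pow_commute[of c w "- n"] that by (simp add: central int_pow_neg)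
  have "b [^] n \<otimes> a = a \<otimes> b [^] n \<otimes> inv ?d"
    using int_pow_swap_right[OF assms, of n] by (simp add: m_assoc)
  then have "b [^] n \<otimes> a [^] m = a [^] m \<otimes> b [^] n \<otimes> inv ?d [^] m"
    by (intro int_pow_swap_right) (simp_all add: d_central)
  then have "b [^] n \<otimes> a [^] m \<otimes> ?d [^] m = a [^] m \<otimes> b [^] n"
    by (simp add: m_assoc int_pow_inv)
  then show ?thesis by (simp add: int_pow_pow mult.commute)
qed

end

primrec ordered_prod :: "('a, 'b) monoid_scheme \<Rightarrow> (nat \<Rightarrow> 'a) \<Rightarrow> (nat \<Rightarrow> int) \<Rightarrow> nat \<Rightarrow> 'a" where
  "ordered_prod G x f 0 = \<one>\<^bsub>G\<^esub>"
| "ordered_prod G x f (Suc n) = ordered_prod G x f n \<otimes>\<^bsub>G\<^esub> x n [^]\<^bsub>G\<^esub> f n"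

lemma (in group) ordered_prod_closed:
  "(\<And>i. x i \<in> carrier G) \<Longrightarrow> ordered_prod G x f n \<in> carrier G"
  by (induction n) auto

lemma (in group_hom) hom_ordered_prod:
  assumes "\<And>i. x i \<in> carrier G"
  shows "h (ordered_prod G x f n) = ordered_prod H (\<lambda>i. h (x i)) f n"
  using assms by (induction n) (simp_all add: hom_int_pow G.ordered_prod_closed)

text \<open>\<open>form\<close> vanishes on two monomials of equal degree, so powers of a generator
  pick up no central correction.\<close>

lemma int_pow_monom_heis: "(monom 1 n, 0) [^]\<^bsub>heis\<^esub> (a::int) = (monom a n, 0)"
  by (cases a rule: int_cases2)
    (simp_all add: group.int_pow_neg_int[OF group_heis] int_pow_int nat_pow_heis form_monom
      smult_monom flip: minus_monom)

lemma ordered_prod_heis: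
  "ordered_prod heis (\<lambda>i. (monom 1 i, 0)) f n = (\<Sum>k<n. monom (f k) k, 0)"
proof (induction n)
  case (Suc n)
  \<comment> \<open>Corrections arise only when a larger index stands to the left of a smaller one,
    which never happens in increasing order.\<close>
  have "form (\<Sum>k<m. monom (f k) k) (monom a n) = 0" if "m \<le> n" for m a
    using that by (induction m) (auto simp: form_add_left form_monom)
  then show ?case using Suc by (simp add: int_pow_monom_heis)
qed simp

lemma int_pow_central_heis: "(0, 1) [^]\<^bsub>heis\<^esub> (c::int) = (0, c)"
  by (cases c rule: int_cases2)
    (simp_all add: group.int_pow_neg_int[OF group_heis] int_pow_int nat_pow_heis)

section \<open>Multiplication of ordered products in a group that satisfies the relations\<close>

locale E_generators = group G for G (structure) +
  fixes p :: nat and x :: "nat \<Rightarrow> 'a" and z :: 'a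
  assumes in_N2: "in_N2 p G"
    and x_closed [simp]: "x i \<in> carrier G"
    and comm: "i < k \<Longrightarrow> commutator G (x i) (x k) = z"
begin

lemma z_closed [simp]: "z \<in> carrier G"
  using commutator_closed[OF group_axioms x_closed x_closed, of 0 1] comm[of 0 1] by simp

text \<open>\<open>z\<close> is the commutator of \<open>x 0\<close> and \<open>x 1\<close>, so the
  law of class 2 applies to it.\<close>

lemma z_central: "w \<in> carrier G \<Longrightarrow> z \<otimes> w = w \<otimes> z"
proof -
  assume w: "w \<in> carrier G"
  have "commutator G z w \<in> N2_law_values p G"
    unfolding N2_law_values_def using w comm[of 0 1] x_closed zero_less_one by blast
  then have "commutator G z w = \<one>" using in_N2 by (auto simp: in_N2_def)
  then show ?thesis using commutator_swap[of z w] w by simp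
qed

lemma z_pow_central: "w \<in> carrier G \<Longrightarrow> z [^] (n::int) \<otimes> w = w \<otimes> z [^] n"
  by (intro int_pow_commute z_central) auto

lemma x_swap: "i < k \<Longrightarrow> x k [^] (a::int) \<otimes> x i [^] (b::int) = x i [^] b \<otimes> x k [^] a \<otimes> z [^] (- (a * b))"
proof -
  assume "i < k"
  then have "x i [^] b \<otimes> x k [^] a = x k [^] a \<otimes> x i [^] b \<otimes> z [^] (b * a)"
    using comm commutator_swap[of "x i" "x k"] by (intro int_pow_swap z_central) auto
  then show ?thesis by (simp add: m_assoc int_pow_neg mult.commute)
qed

abbreviation P :: "(nat \<Rightarrow> int) \<Rightarrow> nat \<Rightarrow> 'a" where
  "P \<equiv> ordered_prod G x"

lemma P_closed [simp]: "P f n \<in> carrier G"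
  by (rule ordered_prod_closed) simp

lemma x_P_swap:
  "n \<le> k \<Longrightarrow> x k [^] (a::int) \<otimes> P g n = P g n \<otimes> x k [^] a \<otimes> z [^] (- (a * (\<Sum>i<n. g i)))"
proof (induction n)
  case (Suc n)
  let ?s = "\<Sum>i<n. g i"
  have "x k [^] a \<otimes> P g (Suc n) = (x k [^] a \<otimes> P g n) \<otimes> x n [^] g n"
    by (simp add: m_assoc)
  also have "\<dots> = P g n \<otimes> x k [^] a \<otimes> (z [^] (- (a * ?s)) \<otimes> x n [^] g n)"
    using Suc by (simp add: m_assoc)
  also have "\<dots> = P g n \<otimes> (x k [^] a \<otimes> x n [^] g n) \<otimes> z [^] (- (a * ?s))"
    by (subst z_pow_central) (simp_all add: m_assoc)
  also have "\<dots> = P g n \<otimes> x n [^] g n \<otimes> x k [^] a \<otimes> (z [^] (- (a * g n)) \<otimes> z [^] (- (a * ?s)))"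
    using Suc.prems by (simp add: x_swap m_assoc)
  also have "z [^] (- (a * g n)) \<otimes> z [^] (- (a * ?s)) = z [^] (- (a * (\<Sum>i<Suc n. g i)))"
    by (subst int_pow_mult[symmetric]) (simp_all add: algebra_simps)
  finally show ?case by simp
qed simp

text \<open>At stage \<open>n\<close> the new cost comes from moving \<open>x n [^] f n\<close>
  across \<open>P g n\<close>; its exponent is the summand of \<open>form_upto\<close> at index
  \<open>n\<close>.\<close>

lemma P_mult:
  "P f n \<otimes> P g n = P (\<lambda>i. f i + g i) n \<otimes> z [^] (- form_upto n f g)"
proof (induction n)
  case (Suc n)
  let ?s = "\<Sum>i<n. g i"
  have "P f (Suc n) \<otimes> P g (Suc n) = P f n \<otimes> (x n [^] f n \<otimes> P g n) \<otimes> x n [^] g n"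
    by (simp add: m_assoc)
  also have "\<dots> = P f n \<otimes> P g n \<otimes> x n [^] f n \<otimes> (z [^] (- (f n * ?s)) \<otimes> x n [^] g n)"
    by (simp add: x_P_swap m_assoc)
  also have "\<dots> = (P f n \<otimes> P g n) \<otimes> (x n [^] f n \<otimes> x n [^] g n) \<otimes> z [^] (- (f n * ?s))"
    by (subst z_pow_central) (simp_all add: m_assoc)
  also have "\<dots> = P (\<lambda>i. f i + g i) n \<otimes> (z [^] (- form_upto n f g) \<otimes> x n [^] (f n + g n))
      \<otimes> z [^] (- (f n * ?s))"
    by (simp add: Suc m_assoc int_pow_mult)
  also have "\<dots> = P (\<lambda>i. f i + g i) (Suc n) \<otimes> (z [^] (- form_upto n f g) \<otimes> z [^] (- (f n * ?s)))"
    by (subst z_pow_central) (simp_all add: m_assoc)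
  also have "z [^] (- form_upto n f g) \<otimes> z [^] (- (f n * ?s)) = z [^] (- form_upto (Suc n) f g)"
    by (subst int_pow_mult[symmetric]) (simp_all add: form_upto_def)
  finally show ?case .
qed (simp add: form_upto_def)

lemma P_mono: "m \<le> n \<Longrightarrow> (\<And>i. m \<le> i \<Longrightarrow> f i = 0) \<Longrightarrow> P f m = P f n"
  by (induction n rule: dec_induct) auto

definition normal_form :: "int poly \<times> int \<Rightarrow> 'a" where
  "normal_form = (\<lambda>(f, c). P (coeff f) (Suc (degree f)) \<otimes> z [^] c)"

lemma normal_form_eq: "(\<And>i. n \<le> i \<Longrightarrow> coeff f i = 0) \<Longrightarrow> normal_form (f, c) = P (coeff f) n \<otimes> z [^] c"
proof -
  assume z: "\<And>i. n \<le> i \<Longrightarrow> coeff f i = 0"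
  have "P (coeff f) (Suc (degree f)) = P (coeff f) (max n (Suc (degree f)))"
    by (rule P_mono) (auto simp: coeff_eq_0)
  also have "\<dots> = P (coeff f) n"
    by (rule P_mono[symmetric]) (auto simp: z)
  finally show ?thesis by (simp add: normal_form_def)
qed

text \<open>\<open>heis\<close> is modelled on \<open>P_mult\<close>. The image of a homomorphism is
  a subgroup, so surjectivity becomes a question about generators.\<close>

lemma normal_form_hom: "group_hom heis G normal_form"
proof -
  have "normal_form (f, c) \<otimes> normal_form (g, d) = normal_form (f + g, c + d - form f g)" for f c g d
  proof -
    let ?n = "Suc (max (degree f) (degree g))"
    have "normal_form (f, c) \<otimes> normal_form (g, d) = P (coeff f) ?n \<otimes> (z [^] c \<otimes> P (coeff g) ?n) \<otimes> z [^] d"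
      by (simp add: normal_form_eq[of ?n] coeff_eq_0 m_assoc del: ordered_prod.simps)
    also have "\<dots> = (P (coeff f) ?n \<otimes> P (coeff g) ?n) \<otimes> (z [^] c \<otimes> z [^] d)"
      by (subst z_pow_central) (simp_all add: m_assoc del: ordered_prod.simps)
    also have "\<dots> = P (coeff (f + g)) ?n \<otimes> z [^] (c + d - form f g)"
      by (simp add: P_mult form_eq_upto[of ?n] coeff_eq_0 m_assoc plus_poly.rep_eq algebra_simps
          del: ordered_prod.simps flip: int_pow_mult)
    also have "\<dots> = normal_form (f + g, c + d - form f g)"
      by (simp add: normal_form_eq[of ?n] coeff_eq_0 del: ordered_prod.simps)
    finally show ?thesis .
  qed
  moreover have "normal_form a \<in> carrier G" for a
    by (cases a) (simp add: normal_form_def del: ordered_prod.simps)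
  ultimately show ?thesis
    by (auto simp: group_hom_def group_hom_axioms_def group_heis intro!: homI)
qed

lemma int_pow_cong:
  assumes "w \<in> carrier G" "int p dvd a - b"
  shows "w [^] a = w [^] b"
proof -
  obtain q where "a - b = int p * q" using assms(2) by (rule dvdE)
  then have a: "a = b + int p * q" by simp
  have "w [^] p \<in> N2_law_values p G" using assms(1) by (auto simp: N2_law_values_def)
  then have "w [^] (int p) = \<one>" using in_N2 by (auto simp: in_N2_def int_pow_int)
  then have "w [^] (int p * q) = \<one>" using assms(1) int_pow_pow[of w "int p" q] by simp
  then show ?thesis using assms(1) by (simp add: a int_pow_mult)
qed

lemma normal_form_cong:
  assumes "\<And>i. int p dvd coeff f i - coeff g i" "int p dvd c - d"
  shows "normal_form (f, c) = normal_form (g, d)"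
proof -
  let ?n = "Suc (max (degree f) (degree g))"
  have "P (coeff f) n = P (coeff g) n" for n
    by (induction n) (simp_all add: int_pow_cong[OF _ assms(1)])
  then show ?thesis
    using int_pow_cong[OF z_closed assms(2)]
    by (simp add: normal_form_eq[of ?n] coeff_eq_0 del: ordered_prod.simps)
qed

lemma x_eq_normal_form: "x i = normal_form (monom 1 i, 0)"
proof -
  have "P (coeff (monom 1 i)) n = \<one>" if "n \<le> i" for n
    using that by (induction n) auto
  then show ?thesis using normal_form_eq[of "Suc i" "monom 1 i" 0] by simp
qed

lemma z_eq_normal_form: "z = normal_form (0, 1)"
  using normal_form_eq[of 0 0 1] by simp

end

text \<open>\<open>generated\<close> will make every element a normal form; \<open>\<phi>\<close>, a
  map back to the model modulo \<open>p\<close>, will keep different exponents apart.\<close>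

locale E_presentation = E_generators +
  fixes \<phi>
  assumes \<phi>_hom: "\<phi> \<in> hom G (heis Mod heis_mod p)"
    and \<phi>_x: "\<phi> (x i) = heis_mod p #>\<^bsub>heis\<^esub> (monom 1 i, 0)"
    and \<phi>_z: "\<phi> z = heis_mod p #>\<^bsub>heis\<^esub> (0, 1)"
    and generated: "subgroup K G \<Longrightarrow> range x \<subseteq> K \<Longrightarrow> z \<in> K \<Longrightarrow> carrier G \<subseteq> K"
begin

lemma surj_normal_form: "range normal_form = carrier G"
proof -
  interpret group_hom heis G normal_form by (rule normal_form_hom)
  have "carrier G \<subseteq> range normal_form"
  proof (rule generated)
    show "subgroup (range normal_form) G" using img_is_subgroup by simp
    show "range x \<subseteq> range normal_form" by (subst x_eq_normal_form[abs_def]) blast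
    show "z \<in> range normal_form" by (subst z_eq_normal_form) (rule rangeI)
  qed
  then show ?thesis using hom_closed by fastforce
qed

text \<open>Evaluating a normal form at the generators of \<open>heis\<close> itself returns the
  pair: the monomials of \<open>f\<close> sum to \<open>f\<close> without correction.
  \<open>\<phi>\<close> matches generators, hence it recovers the pair modulo
  \<open>p\<close>.\<close>

lemma \<phi>_normal_form: "\<phi> (normal_form a) = heis_mod p #>\<^bsub>heis\<^esub> a"
proof -
  let ?k = "\<lambda>a. heis_mod p #>\<^bsub>heis\<^esub> a"
  interpret k: group_hom heis "heis Mod heis_mod p" ?k
    by (rule group_hom_Mod[OF normal_heis_mod])
  interpret \<phi>: group_hom G "heis Mod heis_mod p" \<phi>
    by (simp add: group_hom_def group_hom_axioms_def \<phi>_hom group_axioms)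
  obtain f c where a: "a = (f, c)" by (cases a)
  let ?n = "Suc (degree f)"
  have f: "(\<Sum>k<?n. monom (coeff f k) k) = f"
    by (simp only: lessThan_Suc_atMost poly_as_sum_of_monoms)
  have "\<phi> (normal_form a) = ordered_prod (heis Mod heis_mod p) (\<lambda>i. ?k (monom 1 i, 0)) (coeff f) ?n
      \<otimes>\<^bsub>heis Mod heis_mod p\<^esub> ?k (0, 1) [^]\<^bsub>heis Mod heis_mod p\<^esub> c"
    by (simp add: a normal_form_def \<phi>.hom_ordered_prod \<phi>.hom_int_pow \<phi>_x \<phi>_z del: ordered_prod.simps)
  also have "\<dots> = ?k (ordered_prod heis (\<lambda>i. (monom 1 i, 0)) (coeff f) ?n
      \<otimes>\<^bsub>heis\<^esub> (0, 1) [^]\<^bsub>heis\<^esub> c)"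
    by (simp add: k.hom_ordered_prod k.hom_int_pow k.hom_mult del: ordered_prod.simps mult_heis)
  also have "\<dots> = ?k a"
    by (simp only: ordered_prod_heis int_pow_central_heis f mult_heis a) simp
  finally show ?thesis .
qed

lemma normal_form_eq_iff:
  "normal_form (f, c) = normal_form (g, d) \<longleftrightarrow> (\<forall>i. int p dvd coeff f i - coeff g i) \<and> int p dvd c - d"
  using rcoset_heis_mod_eq[of p f c g d] normal_form_cong[of f g c d] \<phi>_normal_form by metis

end

section \<open>The multiplication automaton\<close>

definition letter_at :: "'a list \<Rightarrow> nat \<Rightarrow> 'a option" where
  "letter_at w j = (if j < length w then Some (w ! j) else None)"

lemma letter_at_Nil [simp]: "letter_at [] j = None"
  by (simp add: letter_at_def)

lemma convolution_letter_at:
  "convolution ws = map (\<lambda>j. map (\<lambda>w. letter_at w j) ws) [0..<Max (length ` set ws)]"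
  by (simp add: convolution_def letter_at_def)

text \<open>A letter is a number below \<open>p\<^sup>2\<close>.  In position \<open>i\<close> it contributes its last \<open>p\<close>-adic digit to
  the exponent of \<open>x\<^sub>i\<close> and its other digit to the exponent of \<open>z\<close>.\<close>

definition digit :: "nat \<Rightarrow> nat option \<Rightarrow> int" where
  "digit p l = (case l of None \<Rightarrow> 0 | Some a \<Rightarrow> int (a mod p))"

definition carry :: "nat \<Rightarrow> nat option \<Rightarrow> int" where
  "carry p l = (case l of None \<Rightarrow> 0 | Some a \<Rightarrow> int (a div p))"

lemma digit_carry_None [simp]: "digit p None = 0" "carry p None = 0"
  by (simp_all add: digit_def carry_def)

definition exponents :: "nat \<Rightarrow> nat list \<Rightarrow> int poly \<times> int" where
  "exponents p w = (Poly (map (\<lambda>a. digit p (Some a)) w), \<Sum>j<length w. carry p (letter_at w j))"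

lemma coeff_exponents: "coeff (fst (exponents p w)) i = digit p (letter_at w i)"
  by (simp add: exponents_def coeff_Poly_eq nth_default_def letter_at_def)

lemma snd_exponents:
  "length w \<le> n \<Longrightarrow> snd (exponents p w) = (\<Sum>j<n. carry p (letter_at w j))"
  unfolding exponents_def snd_conv by (rule sum.mono_neutral_left) (auto simp: letter_at_def)

text \<open>The multiplication automaton reads letters \<open>u, v, w\<close> of the two factors and of the product.
  Its state holds, modulo \<open>p\<close>, the sum \<open>S\<close> of the digits of the second factor read so far and
  the defect \<open>T\<close> in the exponent of \<open>z\<close>.\<close>

definition mult_step ::
  "nat \<Rightarrow> (int \<times> int) option \<Rightarrow> nat option \<Rightarrow> nat option \<Rightarrow> nat option \<Rightarrow> (int \<times> int) option" where
  "mult_step p s u v w = (case s of None \<Rightarrow> None | Some (S, T) \<Rightarrow>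
     if int p dvd digit p u + digit p v - digit p w
     then Some ((S + digit p v) mod int p,
       (T + carry p u + carry p v - carry p w - digit p u * S) mod int p)
     else None)"

definition mult_states :: "nat \<Rightarrow> (int \<times> int) option set" where
  "mult_states p = insert None (Some ` ({0..<int p} \<times> {0..<int p}))"

lemma mult_step_closed: "0 < p \<Longrightarrow> mult_step p s u v w \<in> mult_states p"
  by (auto simp: mult_step_def mult_states_def split: option.splits prod.splits)

text \<open>Reducing the state before a step does not affect the result, so a run can be described
  by exact sums that are reduced once.\<close>

lemma mult_step_mod:
  "mult_step p (Some (S mod int p, T mod int p)) u v w =
    (if int p dvd digit p u + digit p v - digit p w
     then Some ((S + digit p v) mod int p,
       (T + carry p u + carry p v - carry p w - digit p u * S) mod int p)
     else None)"
proof -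
  have "(T mod int p + carry p u + carry p v - carry p w - digit p u * (S mod int p)) mod int p
    = (T + carry p u + carry p v - carry p w - digit p u * S) mod int p"
    by (intro mod_diff_cong mod_add_cong mod_mult_cong) simp_all
  then show ?thesis by (simp add: mult_step_def mod_add_left_eq)
qed

text \<open>Column \<open>n\<close> subtracts its first digit times the sum of the second digits
  before it. As \<open>S\<close> is used before its update, this is the summand of
  \<open>form_upto\<close> at \<open>n\<close>, with strict inequality of indices.\<close>

lemma mult_run:
  "foldl (\<lambda>s j. mult_step p s (u j) (v j) (w j)) (Some (0, 0)) [0..<n] =
    (if \<forall>j<n. int p dvd digit p (u j) + digit p (v j) - digit p (w j)
     then Some ((\<Sum>j<n. digit p (v j)) mod int p,
       ((\<Sum>j<n. carry p (u j)) + (\<Sum>j<n. carry p (v j)) - (\<Sum>j<n. carry p (w j))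
         - form_upto n (\<lambda>j. digit p (u j)) (\<lambda>j. digit p (v j))) mod int p)
     else None)"
proof (induction n)
  case 0
  then show ?case by (simp add: form_upto_def)
next
  case (Suc n)
  let ?run = "\<lambda>n. foldl (\<lambda>s j. mult_step p s (u j) (v j) (w j)) (Some (0, 0)) [0..<n]"
  let ?S = "\<Sum>j<n. digit p (v j)"
  let ?T = "(\<Sum>j<n. carry p (u j)) + (\<Sum>j<n. carry p (v j)) - (\<Sum>j<n. carry p (w j))
    - form_upto n (\<lambda>j. digit p (u j)) (\<lambda>j. digit p (v j))"
  have step: "?run (Suc n) = mult_step p (?run n) (u n) (v n) (w n)" by simp
  show ?case
  proof (cases "\<forall>j<n. int p dvd digit p (u j) + digit p (v j) - digit p (w j)")
    case True
    then have "?run n = Some (?S mod int p, ?T mod int p)" using Suc by simp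
    then have "?run (Suc n) = (if int p dvd digit p (u n) + digit p (v n) - digit p (w n)
      then Some ((?S + digit p (v n)) mod int p,
        (?T + carry p (u n) + carry p (v n) - carry p (w n) - digit p (u n) * ?S) mod int p)
      else None)"
      by (simp only: step mult_step_mod)
    from this True show ?thesis
      by (simp only: All_less_Suc) (auto simp: form_upto_def algebra_simps)
  next
    case False
    then have "?run n = None" using Suc by auto
    then show ?thesis
      unfolding step using False by (auto simp: mult_step_def All_less_Suc)
  qed
qed

section \<open>Words as representatives of group elements\<close>

context E_presentation
begin

definition rep :: "nat list \<Rightarrow> 'a" where
  "rep w = normal_form (exponents p w)"

lemma rep_Nil [simp]: "rep [] = \<one>"
  by (simp add: rep_def exponents_def normal_form_eq[of 0])

lemma rep_closed [simp]: "rep w \<in> carrier G"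
  using surj_normal_form by (auto simp: rep_def)

text \<open>Acceptance means that all digits matched and the defect ended at 0, which is equality by
  \<open>normal_form_eq_iff\<close>. Any common bound \<open>n\<close> works because fillers count
  as zero.\<close>

lemma rep_mult_iff:
  assumes "length \<sigma> \<le> n" "length \<tau> \<le> n" "length \<rho> \<le> n"
  shows "rep \<sigma> \<otimes> rep \<tau> = rep \<rho> \<longleftrightarrow>
    foldl (\<lambda>s j. mult_step p s (letter_at \<sigma> j) (letter_at \<tau> j) (letter_at \<rho> j))
      (Some (0, 0)) [0..<n] \<in> range (\<lambda>S. Some (S, 0))"
proof -
  interpret normal_form: group_hom heis G normal_form by (rule normal_form_hom)
  obtain f c g d h e where ex: "exponents p \<sigma> = (f, c)" "exponents p \<tau> = (g, d)" "exponents p \<rho> = (h, e)"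
    by (meson surj_pair)
  have coeffs: "coeff f = (\<lambda>j. digit p (letter_at \<sigma> j))" "coeff g = (\<lambda>j. digit p (letter_at \<tau> j))"
    "coeff h = (\<lambda>j. digit p (letter_at \<rho> j))"
    using coeff_exponents[of p \<sigma>] coeff_exponents[of p \<tau>] coeff_exponents[of p \<rho>] by (auto simp: ex)
  have carries: "c = (\<Sum>j<n. carry p (letter_at \<sigma> j))" "d = (\<Sum>j<n. carry p (letter_at \<tau> j))"
    "e = (\<Sum>j<n. carry p (letter_at \<rho> j))"
    using snd_exponents[OF assms(1), of p] snd_exponents[OF assms(2), of p]
      snd_exponents[OF assms(3), of p] by (auto simp: ex)
  have zero: "digit p (letter_at w j) = 0" if "length w \<le> n" "n \<le> j" for w j
    using that by (simp add: letter_at_def)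
  have form: "form f g = form_upto n (coeff f) (coeff g)"
    by (rule form_eq_upto) (simp add: coeffs zero[OF assms(1)])
  have "rep \<sigma> \<otimes> rep \<tau> = normal_form (f + g, c + d - form f g)"
    by (simp add: rep_def ex flip: normal_form.hom_mult)
  then have "rep \<sigma> \<otimes> rep \<tau> = rep \<rho> \<longleftrightarrow>
      (\<forall>j. int p dvd coeff f j + coeff g j - coeff h j) \<and> int p dvd c + d - e - form f g"
    by (simp add: rep_def ex normal_form_eq_iff algebra_simps)
  \<comment> \<open>From \<open>n\<close> on all three digits are 0, so only the congruences seen by
    the automaton remain.\<close>
  also have "(\<forall>j. int p dvd coeff f j + coeff g j - coeff h j) \<longleftrightarrow>
      (\<forall>j<n. int p dvd coeff f j + coeff g j - coeff h j)"
    using assms by (auto simp: coeffs zero not_less) (metis dvd_0_right zero diff_0 add_0 not_less minus_zero)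
  finally show ?thesis
    by (auto simp: mult_run carries form coeffs dvd_eq_mod_eq_0)
qed

lemma rep_surj:
  assumes "0 < p"
  shows "rep ` lists {0..<p * p} = carrier G"
proof
  show "carrier G \<subseteq> rep ` lists {0..<p * p}"
  proof
    fix g assume "g \<in> carrier G"
    then obtain f c where g: "g = normal_form (f, c)" using surj_normal_form by force
    define a where "a i = nat (coeff f i mod int p)" for i
    define b where "b = nat (c mod int p)"
    \<comment> \<open>The whole exponent of \<open>z\<close> goes into letter 0, which exists even
      for \<open>f = 0\<close> because the word has length \<open>Suc (degree f)\<close>.\<close>
    define l where "l i = a i + (if i = 0 then p * b else 0)" for i
    let ?n = "Suc (degree f)"
    let ?w = "map l [0..<?n]"
    have a: "int (a i) = coeff f i mod int p" "a i < p" for i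
      using assms by (simp_all add: a_def nat_less_iff)
    have b: "int b = c mod int p" "b < p"
      using assms by (simp_all add: b_def nat_less_iff)
    have l: "l i mod p = a i" "l i div p = (if i = 0 then b else 0)" for i
      using a(2)[of i] by (cases "i = 0"; simp add: l_def)+
    have "l i < p * p" for i
    proof -
      have "l i < Suc b * p" using l(2)[of i] assms
        by (metis div_less_iff_less_mult less_Suc_eq zero_less_Suc)
      also have "\<dots> \<le> p * p" using b(2) by (intro mult_le_mono1) simp
      finally show ?thesis .
    qed
    then have w: "?w \<in> lists {0..<p * p}" by auto
    have "coeff (fst (exponents p ?w)) i = coeff f i mod int p" for i
      by (cases "i < ?n")
        (auto simp: coeff_exponents letter_at_def digit_def l a(1) coeff_eq_0 simp del: upt_Suc)
    moreover have "snd (exponents p ?w) = (\<Sum>j<?n. int (if j = 0 then b else 0))"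
      by (subst snd_exponents[of _ ?n])
        (auto simp: letter_at_def carry_def l simp del: upt_Suc sum.lessThan_Suc intro!: sum.cong)
    then have "snd (exponents p ?w) = c mod int p"
      by (simp add: sum.lessThan_Suc_shift b(1) del: sum.lessThan_Suc)
    ultimately have "rep ?w = normal_form (f, c)"
      unfolding rep_def by (cases "exponents p ?w") (auto simp flip: mod_eq_dvd_iff intro!: normal_form_cong)
    then show "g \<in> rep ` lists {0..<p * p}" using g w by (metis image_eqI)
  qed
qed auto

lemma word_automatic:
  assumes "0 < p"
  shows "word_automatic G"
proof -
  let ?A = "{0..<p * p}"
  let ?F = "range (\<lambda>S :: int. Some (S, 0 :: int))"
  have states: "finite (mult_states p)" "Some (0, 0) \<in> mult_states p"
    using assms by (auto simp: mult_states_def)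
  \<comment> \<open>Fillers as second factor stand for the empty word, which represents the
    identity; equality is tested as
    \<open>rep \<sigma> \<otimes> rep [] = rep \<tau>\<close>.\<close>
  let ?eq = "\<lambda>s c. mult_step p s (c ! 0) None (c ! 1)"
  let ?mul = "\<lambda>s c. mult_step p s (c ! 0) (c ! 1) (c ! 2)"
  have two: "{ws. length ws = 2 \<and> Q ws} = {[\<sigma>, \<tau>] | \<sigma> \<tau>. Q [\<sigma>, \<tau>]}" for Q :: "nat list list \<Rightarrow> bool"
    by (auto simp: numeral_2_eq_2 length_Suc_conv)
  have three: "{ws. length ws = 3 \<and> Q ws} = {[\<sigma>, \<tau>, \<rho>] | \<sigma> \<tau> \<rho>. Q [\<sigma>, \<tau>, \<rho>]}"
    for Q :: "nat list list \<Rightarrow> bool"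
    by (auto simp: numeral_3_eq_3 length_Suc_conv)
  have run_eq: "foldl ?eq (Some (0, 0)) (convolution [\<sigma>, \<tau>]) \<in> ?F \<longleftrightarrow> rep \<sigma> = rep \<tau>" for \<sigma> \<tau>
    using rep_mult_iff[of \<sigma> "max (length \<sigma>) (length \<tau>)" "[]" \<tau>]
    by (simp add: convolution_letter_at foldl_map)
  have eq: "{[\<sigma>, \<tau>] | \<sigma> \<tau>. \<sigma> \<in> lists ?A \<and> \<tau> \<in> lists ?A \<and> rep \<sigma> = rep \<tau>} =
      {ws. length ws = 2 \<and> set ws \<subseteq> lists ?A \<and> foldl ?eq (Some (0, 0)) (convolution ws) \<in> ?F}"
    by (simp only: two run_eq list.set insert_subset empty_subsetI simp_thms conj_assoc)
  have run_mul: "foldl ?mul (Some (0, 0)) (convolution [\<sigma>, \<tau>, \<rho>]) \<in> ?F \<longleftrightarrow> rep \<sigma> \<otimes> rep \<tau> = rep \<rho>" for \<sigma> \<tau> \<rho>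
    using rep_mult_iff[of \<sigma> "max (length \<sigma>) (max (length \<tau>) (length \<rho>))" \<tau> \<rho>]
    by (simp add: convolution_letter_at foldl_map)
  have mul: "{[\<sigma>, \<tau>, \<rho>] | \<sigma> \<tau> \<rho>. \<sigma> \<in> lists ?A \<and> \<tau> \<in> lists ?A \<and> \<rho> \<in> lists ?A
        \<and> rep \<sigma> \<otimes> rep \<tau> = rep \<rho>} =
      {ws. length ws = 3 \<and> set ws \<subseteq> lists ?A \<and> foldl ?mul (Some (0, 0)) (convolution ws) \<in> ?F}"
    by (simp only: three run_mul list.set insert_subset empty_subsetI simp_thms conj_assoc)
  have "FA_recognizable 2 ?A {[\<sigma>, \<tau>] | \<sigma> \<tau>. \<sigma> \<in> lists ?A \<and> \<tau> \<in> lists ?A \<and> rep \<sigma> = rep \<tau>}"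
    unfolding eq using assms states by (intro FA_recognizableI[where Q = "mult_states p"] mult_step_closed) auto
  moreover have "FA_recognizable 3 ?A {[\<sigma>, \<tau>, \<rho>] | \<sigma> \<tau> \<rho>. \<sigma> \<in> lists ?A \<and> \<tau> \<in> lists ?A \<and> \<rho> \<in> lists ?A
        \<and> rep \<sigma> \<otimes> rep \<tau> = rep \<rho>}"
    unfolding mul using assms states by (intro FA_recognizableI[where Q = "mult_states p"] mult_step_closed) auto
  ultimately show ?thesis
    unfolding word_automatic_def using group_axioms regular_over_lists rep_surj[OF assms]
    by (intro conjI exI[of _ ?A] exI[of _ "lists ?A"] exI[of _ rep]) auto
qed

end

section \<open>Presentations in the variety\<close>

text \<open>By induction on words: an inverse letter goes to the inverse of the image of its
  generator, hence also into \<open>K\<close>.\<close>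

lemma free_group_hom_in_subgroup:
  assumes q: "group_hom free_group G q" and K: "subgroup K G"
    and gens: "\<And>a. q (word_rel `` {[(a, True)]}) \<in> K"
    and u: "u \<in> carrier free_group"
  shows "q u \<in> K"
proof -
  interpret q: group_hom free_group G q by fact
  have closed: "word_rel `` {w} \<in> carrier free_group" for w
    by (simp add: free_group_carrier)
  have one: "\<one>\<^bsub>free_group\<^esub> = word_rel `` {[]}" by (simp add: free_group_def)
  have letter: "q (word_rel `` {[(a, s)]}) \<in> K" for a s
  proof (cases s)
    case False
    have "word_rel `` {[(a, False)]} \<otimes>\<^bsub>free_group\<^esub> word_rel `` {[(a, True)]} = \<one>\<^bsub>free_group\<^esub>"
      using equiv_class_eq[OF equiv_word_rel word_rel_inverse[of "[(a, True)]"]]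
      by (simp add: free_group_mult one)
    then have "q (word_rel `` {[(a, False)]}) = inv\<^bsub>G\<^esub> q (word_rel `` {[(a, True)]})"
      by (metis closed q.G.inv_equality q.hom_inv)
    then show ?thesis using False gens K by (simp add: subgroup.m_inv_closed)
  qed (simp add: gens)
  have "q (word_rel `` {w}) \<in> K" for w
  proof (induction w)
    case Nil
    show ?case using K q.hom_one by (simp add: one subgroup.one_closed)
  next
    case (Cons b w)
    have "q (word_rel `` {b # w}) = q (word_rel `` {[b]}) \<otimes>\<^bsub>G\<^esub> q (word_rel `` {w})"
      using free_group_mult[of "[b]" w] by (simp add: closed flip: q.hom_mult)
    then show ?case using Cons letter K by (cases b) (simp add: subgroup.m_closed)
  qed
  then show ?thesis using u by (auto simp: free_group_carrier)
qed

locale presentation_N2 =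
  fixes p :: nat and R :: "(('a \<times> bool) list set set \<times> ('a \<times> bool) list set set) set"
  assumes R_closed: "R \<subseteq> carrier (free_N2 p) \<times> carrier (free_N2 p)"
begin

abbreviation relators :: "('a \<times> bool) list set set set" where
  "relators \<equiv> {u \<otimes>\<^bsub>free_N2 p\<^esub> inv\<^bsub>free_N2 p\<^esub> v | u v. (u, v) \<in> R}"

definition proj :: "('a \<times> bool) list set set \<Rightarrow> ('a \<times> bool) list set set set" where
  "proj u = normal_closure (free_N2 p) relators #>\<^bsub>free_N2 p\<^esub> u"

lemma relators_normal: "normal_closure (free_N2 p) relators \<lhd> free_N2 p"
proof -
  interpret group "free_N2 p" by (rule group_free_N2)
  show ?thesis
    by (intro normal_normal_closure group_free_N2) (use R_closed in auto)
qed

lemma proj_hom: "group_hom (free_N2 p) (presented_N2 p R) proj"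
  unfolding presented_N2_def proj_def by (rule group_hom_Mod[OF relators_normal])

lemma in_N2_presented: "in_N2 p (presented_N2 p R)"
proof -
  interpret normal "normal_closure (free_N2 p) relators" "free_N2 p" by (rule relators_normal)
  show ?thesis
    unfolding presented_N2_def
    by (rule in_N2_Mod[OF relators_normal]) (use free_N2_in_N2[of p] in \<open>auto simp: in_N2_def\<close>)
qed

lemma proj_relation:
  assumes "(u, v) \<in> R"
  shows "proj u = proj v"
proof -
  interpret group_hom "free_N2 p" "presented_N2 p R" proj by (rule proj_hom)
  interpret N: normal "normal_closure (free_N2 p) relators" "free_N2 p" by (rule relators_normal)
  have uv: "u \<in> carrier (free_N2 p)" "v \<in> carrier (free_N2 p)" using assms R_closed by auto
  have "u \<otimes>\<^bsub>free_N2 p\<^esub> inv\<^bsub>free_N2 p\<^esub> v \<in> normal_closure (free_N2 p) relators"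
    using assms normal_closure_incl[of relators "free_N2 p"] by blast
  then have "proj (u \<otimes>\<^bsub>free_N2 p\<^esub> inv\<^bsub>free_N2 p\<^esub> v) = \<one>\<^bsub>presented_N2 p R\<^esub>"
    by (simp add: proj_def presented_N2_def N.rcos_const)
  then show ?thesis using uv by (simp add: H.inv_solve_right')
qed

text \<open>Relations are pairs in \<open>free_N2 p\<close> and get values in \<open>H\<close> only
  through an extension of \<open>f\<close>, so the premise speaks of every such \<open>h\<close>.
  The kernel of \<open>h\<close> contains the relators, and \<open>h\<close> factors through the
  quotient.\<close>

lemma presented_N2_universal:
  assumes H: "in_N2 p H" and f: "range f \<subseteq> carrier H"
    and rel: "\<And>h u v. group_hom (free_N2 p) H h \<Longrightarrow> (\<And>a. h (gen_N2 p a) = f a) \<Longrightarrow>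
      (u, v) \<in> R \<Longrightarrow> h u = h v"
  shows "\<exists>g \<in> hom (presented_N2 p R) H. \<forall>a. g (proj (gen_N2 p a)) = f a"
proof -
  obtain h where h: "h \<in> hom (free_N2 p) H" "\<And>a. h (gen_N2 p a) = f a"
    using free_N2_universal[OF H f] by blast
  interpret h: group_hom "free_N2 p" H h
    using H h(1) by (simp add: group_hom_def group_hom_axioms_def group_free_N2 in_N2_def)
  have "relators \<subseteq> kernel (free_N2 p) H h"
    using R_closed rel[OF h.group_hom_axioms h(2)] by (fastforce simp: kernel_def)
  then have "normal_closure (free_N2 p) relators \<subseteq> kernel (free_N2 p) H h"
    by (intro normal_closure_least h.normal_kernel)
  from h.FactGroup_universal_kernel[OF relators_normal this] obtain g where
    "g \<in> hom (presented_N2 p R) H" "\<And>u. u \<in> carrier (free_N2 p) \<Longrightarrow> g (proj u) = h u"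
    unfolding presented_N2_def proj_def by blast
  then show ?thesis using h(2) gen_N2_closed by metis
qed

text \<open>The two quotient maps compose to a surjection from the absolutely free group, to which
  \<open>free_group_hom_in_subgroup\<close> applies.\<close>

lemma presented_N2_generated:
  assumes "subgroup K (presented_N2 p R)" "\<And>a. proj (gen_N2 p a) \<in> K"
  shows "carrier (presented_N2 p R) \<subseteq> K"
proof
  let ?k = "\<lambda>u. N2_verbal p #>\<^bsub>free_group\<^esub> u"
  fix g assume "g \<in> carrier (presented_N2 p R)"
  then obtain w where w: "w \<in> carrier free_group" "g = proj (?k w)"
    unfolding presented_N2_def carrier_FactGroup proj_def free_N2_def by auto
  have "?k \<in> hom free_group (free_N2 p)" "proj \<in> hom (free_N2 p) (presented_N2 p R)"
    using group_hom_Mod[OF N2_verbal_normal] proj_hom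
    by (auto simp: group_hom_def group_hom_axioms_def free_N2_def)
  then have "(\<lambda>u. proj (?k u)) \<in> hom free_group (presented_N2 p R)"
    using Group.hom_compose[of ?k free_group "free_N2 p" proj] by (simp add: comp_def)
  then have "group_hom free_group (presented_N2 p R) (\<lambda>u. proj (?k u))"
    using group_free_group group_presented_N2[OF R_closed]
    by (simp add: group_hom_def group_hom_axioms_def)
  from free_group_hom_in_subgroup[OF this assms(1) _ w(1)] show "g \<in> K"
    using assms(2) w(2) by (simp add: gen_N2_def)
qed

end

theorem proposition5p1:
  fixes p :: nat
  assumes "prime p" and "odd p"
  shows "word_automatic (group_E p)"
proof -
  interpret presentation_N2 p "E_relations p"
    by unfold_locales (auto simp: E_relations_def intro: commutator_closed group_free_N2 gen_N2_closed)
  let ?Q = "heis Mod heis_mod p"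
  let ?k = "\<lambda>a. heis_mod p #>\<^bsub>heis\<^esub> a"
  interpret proj: group_hom "free_N2 p" "group_E p" proj
    using proj_hom by (simp add: group_E_def)
  interpret k: group_hom heis ?Q ?k by (rule group_hom_Mod[OF normal_heis_mod])
  define f where "f = (\<lambda>a. ?k (case a of X i \<Rightarrow> (monom 1 i, 0) | Z \<Rightarrow> (0, 1)))"
  have "\<exists>g \<in> hom (group_E p) ?Q. \<forall>a. g (proj (gen_N2 p a)) = f a"
    unfolding group_E_def
  proof (rule presented_N2_universal)
    show "in_N2 p ?Q" using in_N2_heis assms(2) .
    show "range f \<subseteq> carrier ?Q" using k.hom_closed by (auto simp: f_def)
  next
    fix h u v
    assume h: "group_hom (free_N2 p) ?Q h" "\<And>a. h (gen_N2 p a) = f a" and "(u, v) \<in> E_relations p"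
    then obtain i k where ik: "i < k"
      "u = commutator (free_N2 p) (gen_N2 p (X i)) (gen_N2 p (X k))" "v = gen_N2 p Z"
      by (auto simp: E_relations_def)
    have "h u = commutator ?Q (f (X i)) (f (X k))"
      by (simp add: ik(2) hom_commutator[OF h(1)] gen_N2_closed h(2))
    also have "\<dots> = ?k (commutator heis (monom 1 i, 0) (monom 1 k, 0))"
      by (simp add: f_def hom_commutator[OF k.group_hom_axioms])
    \<comment> \<open>For \<open>i < k\<close> the form is 1 on the monomials of degrees
      \<open>k\<close>, \<open>i\<close> and 0 on the reversed pair, so the commutator is
      \<open>(0, 1)\<close>, the model of \<open>Z\<close>.\<close>
    also have "\<dots> = h v"
      using ik(1) by (simp add: commutator_heis form_monom ik(3) h(2) f_def)
    finally show "h u = h v" .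
  qed
  then obtain \<phi> where \<phi>: "\<phi> \<in> hom (group_E p) ?Q" "\<And>a. \<phi> (proj (gen_N2 p a)) = f a"
    by blast
  interpret E_presentation "group_E p" p "\<lambda>i. proj (gen_N2 p (X i))" "proj (gen_N2 p Z)" \<phi>
  proof
    show "in_N2 p (group_E p)" using in_N2_presented by (simp add: group_E_def)
    show "proj (gen_N2 p (X i)) \<in> carrier (group_E p)" for i
      by (simp add: gen_N2_closed)
    show "commutator (group_E p) (proj (gen_N2 p (X i))) (proj (gen_N2 p (X k))) = proj (gen_N2 p Z)"
      if "i < k" for i k
    proof -
      have "(commutator (free_N2 p) (gen_N2 p (X i)) (gen_N2 p (X k)), gen_N2 p Z) \<in> E_relations p"
        using that unfolding E_relations_def by blast
      from proj_relation[OF this] show ?thesis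
        by (simp add: hom_commutator[OF proj.group_hom_axioms] gen_N2_closed)
    qed
    show "\<phi> \<in> hom (group_E p) ?Q" by (rule \<phi>(1))
    show "\<phi> (proj (gen_N2 p (X i))) = ?k (monom 1 i, 0)" for i by (simp add: \<phi>(2) f_def)
    show "\<phi> (proj (gen_N2 p Z)) = ?k (0, 1)" by (simp add: \<phi>(2) f_def)
    fix K assume K: "subgroup K (group_E p)" "range (\<lambda>i. proj (gen_N2 p (X i))) \<subseteq> K"
      "proj (gen_N2 p Z) \<in> K"
    have "proj (gen_N2 p a) \<in> K" for a using K(2,3) by (cases a) auto
    then show "carrier (group_E p) \<subseteq> K"
      using K(1) presented_N2_generated[of K] by (simp add: group_E_def)
  qed
  show ?thesis using word_automatic assms(1) by (simp add: prime_gt_0_nat)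
qed

end
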